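(* The following three properties are equivalent: (C1) the vector $\vec 0\in\mathbb{R}^m$ is attainable by Player 1; (C2) the vector $\vec 0\in\mathbb{R}^m$ is approachable by Player 1; (C3) for every $\lambda\in\mathbb{R}^m$, $v_\lambda\ge 0$.
   Context: **Game.** $A_1,A_2$ are finite nonempty action sets of Players 1 and 2, $m\ge 1$ is an integer, and $u:A_1\times A_2\to[-1,1]^m$ is a vector payoff function, extended bilinearly to $\Delta(A_1)\times\Delta(A_2)$, where $\Delta(A_i)$ is the set of mixed actions (probability distributions on $A_i$). $G=(A_1,A_2,u)$ is the one-shot game. The continuous-time game $\Gamma$ based on $G$ is played over $[0,\infty)$. **Strategies.** Let $\mathcal{C}_i$ be the set of controls of player $i$, i.e. measurable functions $a_i:[0,\infty)\to\Delta(A_i)$; $-i$ denotes the opponent of $i$. A strategy of player $i$ is a function $\sigma_i:\mathcal{C}_{-i}\to\mathcal{C}_i$ for which there is a strictly increasing sequence $0=\tau_i^0<\tau_i^1<\tau_i^2<\cdots$ of real numbers with $\tau_i^k\to\infty$ such that for all $a_{-i},a'_{-i}\in\mathcal{C}_{-i}$ and all $k\ge 0$: if $a_{-i}(t)=a'_{-i}(t)$ for all $t\in[0,\tau_i^k)$, then $(\sigma_i(a_{-i}))(t)=(\sigma_i(a'_{-i}))(t)$ for all $t\in[\tau_i^k,\tau_i^{k+1})$. A pair of strategies $\sigma=(\sigma_1,\sigma_2)$ determines a unique play path $a^\sigma=(a_1,a_2)\in\mathcal{C}_1\times\mathcal{C}_2$ with $\sigma_1(a_2)=a_1$ and $\sigma_2(a_1)=a_2$.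 **Payoffs.** The cumulative payoff up to time $t$ is $\gamma^t(\sigma)=\int_0^t u(a^\sigma(s))\,ds\in\mathbb{R}^m$, and the average payoff is $\overline{\gamma}^t(\sigma)=\frac1t\gamma^t(\sigma)$ for $t>0$. **Distance.** $\|\cdot\|$ is the Euclidean norm and $d(x,A)=\inf_{y\in A}\|x-y\|$. **Attainability.** A nonempty closed set $Y\subseteq\mathbb{R}^m$ is attainable by Player 1 if there is $T>0$ such that for every $\varepsilon>0$ there is a strategy $\sigma_1$ of Player 1 with $d(\gamma^t(\sigma_1,\sigma_2),Y)\le\varepsilon$ for all $t\ge T$ and all strategies $\sigma_2$ of Player 2. **Approachability.** A nonempty closed set $Y\subseteq\mathbb{R}^m$ is approachable by Player 1 if for every $\varepsilon>0$ there exist $T>0$ and a strategy $\sigma_1$ of Player 1 with $d(\overline{\gamma}^t(\sigma_1,\sigma_2),Y)\le\varepsilon$ for all $t\ge T$ and all strategies $\sigma_2$ of Player 2. A vector $x$ is attainable (resp. approachable) by Player 1 if $\{x\}$ is. **Projected games.** For $\lambda\in\mathbb{R}^m$, $v_\lambda$ is the value of the zero-sum one-shot game with action sets $A_1,A_2$ in which Player 2 pays Player 1 the amount $\langle\lambda,u(a_1,a_2)\rangle$; i.e. $v_\lambda=\max_{p\in\Delta(A_1)}\min_{q\in\Delta(A_2)}\langle\lambda,u(p,q)\rangle$. *)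

theory Defs
  imports "HOL-Analysis.Analysis"
begin

text \<open>The action sets are the finite (hence nonempty) types \<open>'a\<close> and \<open>'b\<close>.\<close>

definition mixed_actions :: "(real ^ 'a::finite) set" where
  "mixed_actions = {p. (\<forall>i. 0 \<le> p $ i) \<and> (\<Sum>i\<in>UNIV. p $ i) = 1}"

definition mixed_payoff ::
  "('a::finite \<Rightarrow> 'b::finite \<Rightarrow> real ^ 'm::finite) \<Rightarrow> real ^ 'a \<Rightarrow> real ^ 'b \<Rightarrow> real ^ 'm" where
  "mixed_payoff u p q = (\<Sum>i\<in>UNIV. \<Sum>j\<in>UNIV. (p $ i * q $ j) *\<^sub>R u i j)"

type_synonym 'a control = "real \<Rightarrow> real ^ 'a"

text \<open>Controls are functions on \<open>[0,\<infinity>)\<close>; extensionality fixes their values on negative times,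
  so that equality of controls is equality on \<open>[0,\<infinity>)\<close>.\<close>

definition controls :: "'a::finite control set" where
  "controls = ({0..} \<rightarrow>\<^sub>E mixed_actions) \<inter> (lebesgue_on {0..} \<rightarrow>\<^sub>M borel)"

definition strategies :: "('b::finite control \<Rightarrow> 'a::finite control) set" where
  "strategies = {\<sigma>. \<sigma> \<in> controls \<rightarrow> controls \<and>
     (\<exists>\<tau> :: nat \<Rightarrow> real. \<tau> 0 = 0 \<and> strict_mono \<tau> \<and> filterlim \<tau> at_top sequentially \<and>
       (\<forall>a\<in>controls. \<forall>a'\<in>controls. \<forall>k.
          (\<forall>t\<in>{0..<\<tau> k}. a t = a' t) \<longrightarrow> (\<forall>t\<in>{\<tau> k..<\<tau> (Suc k)}. \<sigma> a t = \<sigma> a' t)))}"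

definition is_play_path ::
  "('b::finite control \<Rightarrow> 'a::finite control) \<Rightarrow> ('a control \<Rightarrow> 'b control)
    \<Rightarrow> 'a control \<times> 'b control \<Rightarrow> bool" where
  "is_play_path \<sigma>1 \<sigma>2 a \<longleftrightarrow>
     fst a \<in> controls \<and> snd a \<in> controls \<and> \<sigma>1 (snd a) = fst a \<and> \<sigma>2 (fst a) = snd a"

definition play_path ::
  "('b::finite control \<Rightarrow> 'a::finite control) \<Rightarrow> ('a control \<Rightarrow> 'b control)
    \<Rightarrow> 'a control \<times> 'b control" where
  "play_path \<sigma>1 \<sigma>2 = (THE a. is_play_path \<sigma>1 \<sigma>2 a)"

definition cumulative_payoff ::
  "('a::finite \<Rightarrow> 'b::finite \<Rightarrow> real ^ 'm::finite) \<Rightarrow> ('b control \<Rightarrow> 'a control)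
    \<Rightarrow> ('a control \<Rightarrow> 'b control) \<Rightarrow> real \<Rightarrow> real ^ 'm" where
  "cumulative_payoff u \<sigma>1 \<sigma>2 t =
     (LINT s:{0..t}|lebesgue.
        mixed_payoff u (fst (play_path \<sigma>1 \<sigma>2) s) (snd (play_path \<sigma>1 \<sigma>2) s))"

definition average_payoff ::
  "('a::finite \<Rightarrow> 'b::finite \<Rightarrow> real ^ 'm::finite) \<Rightarrow> ('b control \<Rightarrow> 'a control)
    \<Rightarrow> ('a control \<Rightarrow> 'b control) \<Rightarrow> real \<Rightarrow> real ^ 'm" where
  "average_payoff u \<sigma>1 \<sigma>2 t = (1 / t) *\<^sub>R cumulative_payoff u \<sigma>1 \<sigma>2 t"

definition attainable_set ::
  "('a::finite \<Rightarrow> 'b::finite \<Rightarrow> real ^ 'm::finite) \<Rightarrow> (real ^ 'm) set \<Rightarrow> bool" where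
  "attainable_set u Y \<longleftrightarrow> Y \<noteq> {} \<and> closed Y \<and>
     (\<exists>T>0. \<forall>\<epsilon>>0. \<exists>\<sigma>1\<in>strategies. \<forall>t\<ge>T. \<forall>\<sigma>2\<in>strategies.
        infdist (cumulative_payoff u \<sigma>1 \<sigma>2 t) Y \<le> \<epsilon>)"

definition approachable_set ::
  "('a::finite \<Rightarrow> 'b::finite \<Rightarrow> real ^ 'm::finite) \<Rightarrow> (real ^ 'm) set \<Rightarrow> bool" where
  "approachable_set u Y \<longleftrightarrow> Y \<noteq> {} \<and> closed Y \<and>
     (\<forall>\<epsilon>>0. \<exists>T>0. \<exists>\<sigma>1\<in>strategies. \<forall>t\<ge>T. \<forall>\<sigma>2\<in>strategies.
        infdist (average_payoff u \<sigma>1 \<sigma>2 t) Y \<le> \<epsilon>)"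

definition attainable ::
  "('a::finite \<Rightarrow> 'b::finite \<Rightarrow> real ^ 'm::finite) \<Rightarrow> real ^ 'm \<Rightarrow> bool" where
  "attainable u x \<longleftrightarrow> attainable_set u {x}"

definition approachable ::
  "('a::finite \<Rightarrow> 'b::finite \<Rightarrow> real ^ 'm::finite) \<Rightarrow> real ^ 'm \<Rightarrow> bool" where
  "approachable u x \<longleftrightarrow> approachable_set u {x}"

text \<open>The supremum and infimum are a maximum and a minimum, as the sets of mixed actions are
  compact and the payoff is bilinear.\<close>

definition game_value ::
  "('a::finite \<Rightarrow> 'b::finite \<Rightarrow> real ^ 'm::finite) \<Rightarrow> real ^ 'm \<Rightarrow> real" where
  "game_value u l = (SUP p\<in>mixed_actions. INF q\<in>mixed_actions. l \<bullet> mixed_payoff u p q)"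

text \<open>The description in \<open>play_path\<close> is proper: any two strategies have exactly one play path.\<close>

lemma strategies_imp_controls: "\<sigma> \<in> strategies \<Longrightarrow> a \<in> controls \<Longrightarrow> \<sigma> a \<in> controls"
  by (auto simp: strategies_def)

lemma controls_eqI:
  assumes "a \<in> controls" "a' \<in> controls" "\<And>t. t \<ge> 0 \<Longrightarrow> a t = a' t"
  shows "a = a'"
  using assms unfolding controls_def by (intro PiE_ext[of a "{0..}" _ a']) auto

lemma delay_sequence:
  fixes \<tau> :: "nat \<Rightarrow> real"
  assumes "\<tau> 0 = 0" "strict_mono \<tau>" "filterlim \<tau> at_top sequentially" "0 \<le> t"
  obtains k where "\<tau> k \<le> t" "t < \<tau> (Suc k)"
proof -
  have "\<exists>n. t < \<tau> n"
    using assms(3) by (auto simp: filterlim_at_top_dense eventually_sequentially)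
  then have L: "t < \<tau> (LEAST n. t < \<tau> n)" by (auto intro: LeastI)
  show ?thesis
  proof (cases "LEAST n. t < \<tau> n")
    case 0
    then show ?thesis using L assms by simp
  next
    case (Suc k)
    then have "\<not> t < \<tau> k" using not_less_Least[of k "\<lambda>n. t < \<tau> n"] by simp
    then show ?thesis using L Suc that[of k] by simp
  qed
qed

lemma strategies_delay:
  fixes \<sigma> :: "'b::finite control \<Rightarrow> 'a::finite control"
  assumes "\<sigma> \<in> strategies"
  shows "\<exists>\<tau> :: nat \<Rightarrow> real. \<tau> 0 = 0 \<and> strict_mono \<tau> \<and> filterlim \<tau> at_top sequentially \<and>
    (\<forall>a\<in>controls. \<forall>a'\<in>controls. \<forall>k.
       (\<forall>s\<in>{0..<\<tau> k}. a s = a' s) \<longrightarrow> (\<forall>t\<in>{0..<\<tau> (Suc k)}. \<sigma> a t = \<sigma> a' t))"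
proof -
  obtain \<tau> :: "nat \<Rightarrow> real"
    where *: "\<tau> 0 = 0 \<and> strict_mono \<tau> \<and> filterlim \<tau> at_top sequentially \<and>
      (\<forall>a\<in>controls. \<forall>a'\<in>controls. \<forall>k.
         (\<forall>t\<in>{0..<\<tau> k}. a t = a' t) \<longrightarrow> (\<forall>t\<in>{\<tau> k..<\<tau> (Suc k)}. \<sigma> a t = \<sigma> a' t))"
    using conjunct2[OF assms[unfolded strategies_def mem_Collect_eq]] by (rule exE)
  note \<tau> = *[THEN conjunct1] *[THEN conjunct2, THEN conjunct1]
    *[THEN conjunct2, THEN conjunct2, THEN conjunct1]
  note d = *[THEN conjunct2, THEN conjunct2, THEN conjunct2, THEN bspec, THEN bspec,
      THEN spec, THEN mp, THEN bspec]
  show ?thesis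
  proof (intro exI[of _ \<tau>] conjI ballI allI impI \<tau>)
    fix a a' :: "'b control" and k t
    assume a: "a \<in> controls" "a' \<in> controls" "\<forall>s\<in>{0..<\<tau> k}. a s = a' s" "t \<in> {0..<\<tau> (Suc k)}"
    obtain j where j: "\<tau> j \<le> t" "t < \<tau> (Suc j)"
      using delay_sequence[OF \<tau>, of t] a(4) by auto
    have "\<tau> j < \<tau> (Suc k)" using j a(4) by simp
    then have "j \<le> k" using \<tau>(2) by (simp add: strict_mono_less)
    then have "\<tau> j \<le> \<tau> k" using \<tau>(2) by (simp add: strict_mono_less_eq)
    then have "\<forall>s\<in>{0..<\<tau> j}. a s = a' s" using a(3) by simp
    then show "\<sigma> a t = \<sigma> a' t" by (rule d[OF a(1,2)]) (simp add: j)
  qed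
qed

lemma strategies_causal:
  assumes "\<sigma> \<in> strategies" "a \<in> controls" "a' \<in> controls"
    and "\<forall>s\<in>{0..<r}. a s = a' s" "t \<in> {0..<r}"
  shows "\<sigma> a t = \<sigma> a' t"
proof -
  obtain \<tau> :: "nat \<Rightarrow> real" where *: "\<tau> 0 = 0 \<and> strict_mono \<tau> \<and> filterlim \<tau> at_top sequentially \<and>
    (\<forall>a\<in>controls. \<forall>a'\<in>controls. \<forall>k.
       (\<forall>s\<in>{0..<\<tau> k}. a s = a' s) \<longrightarrow> (\<forall>t\<in>{0..<\<tau> (Suc k)}. \<sigma> a t = \<sigma> a' t))"
    using strategies_delay[OF assms(1)] by (rule exE)
  note \<tau> = *[THEN conjunct1] *[THEN conjunct2, THEN conjunct1]
    *[THEN conjunct2, THEN conjunct2, THEN conjunct1]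
  note d = *[THEN conjunct2, THEN conjunct2, THEN conjunct2, THEN bspec, THEN bspec,
      THEN spec, THEN mp, THEN bspec]
  obtain k where k: "\<tau> k \<le> t" "t < \<tau> (Suc k)"
    using delay_sequence[OF \<tau>, of t] assms(5) by auto
  have "\<forall>s\<in>{0..<\<tau> k}. a s = a' s" using assms(4) k(1) assms(5) by simp
  then show ?thesis by (rule d[OF assms(2,3)]) (use k assms(5) in simp)
qed

lemma controls_nonempty: "\<exists>a :: 'a::finite control. a \<in> controls"
proof
  define p :: "real ^ 'a" where "p = (\<chi> i. 1 / real CARD('a))"
  have "p \<in> mixed_actions" by (simp add: mixed_actions_def p_def)
  moreover have "(\<lambda>t\<in>{0..}. p) \<in> lebesgue_on {0..} \<rightarrow>\<^sub>M borel"
    by (subst measurable_cong[of _ _ "\<lambda>_. p"]) auto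
  ultimately show "(\<lambda>t\<in>{0..}. p) \<in> controls"
    unfolding controls_def by auto
qed

lemma controls_glue:
  fixes a :: "nat \<Rightarrow> 'a::finite control"
  assumes a: "\<And>n. a n \<in> controls"
    and \<tau>: "filterlim \<tau> at_top sequentially" "strict_mono \<tau>"
    and ag: "\<And>n t. t \<in> {0..<\<tau> n} \<Longrightarrow> a n t = a (Suc n) t"
  obtains b where "b \<in> controls" "\<And>n t. t \<in> {0..<\<tau> n} \<Longrightarrow> b t = a n t"
proof -
  have ag': "a m t = a n t" if "n \<le> m" "t \<in> {0..<\<tau> n}" for n m t
    using that
  proof (induction m rule: dec_induct)
    case (step m)
    then have "\<tau> n \<le> \<tau> m" using \<tau>(2) by (simp add: strict_mono_less_eq)
    then have "t \<in> {0..<\<tau> m}" using step by auto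
    then show ?case using ag[of t m] step by simp
  qed simp
  have ex: "\<exists>n. t < \<tau> n" for t
    using \<tau>(1) by (auto simp: filterlim_at_top_dense eventually_sequentially)
  define b where "b = (\<lambda>t\<in>{0..}. a (LEAST n. t < \<tau> n) t)"
  have L: "t < \<tau> (LEAST n. t < \<tau> n)" for t using ex[of t] by (auto intro: LeastI)
  have eq: "b t = a n t" if "t \<in> {0..<\<tau> n}" for n t
    using that ag'[of "LEAST n. t < \<tau> n" n t] L[of t] Least_le[of "\<lambda>n. t < \<tau> n" n]
    by (simp add: b_def)
  have "b \<in> lebesgue_on {0..} \<rightarrow>\<^sub>M borel"
  proof (rule borel_measurable_LIMSEQ_metric[of a])
    show "a n \<in> lebesgue_on {0..} \<rightarrow>\<^sub>M borel" for n using a[of n] by (simp add: controls_def)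
    fix t :: real assume "t \<in> space (lebesgue_on {0..})"
    then have t: "t \<ge> 0" by simp
    obtain n where n: "t < \<tau> n" using ex[of t] by (elim exE)
    have "eventually (\<lambda>m. a m t = b t) sequentially"
      using eventually_ge_at_top[of n]
    proof eventually_elim
      case (elim m)
      show ?case using ag'[OF elim, of t] eq[of t n] t n by simp
    qed
    then show "(\<lambda>m. a m t) \<longlonglongrightarrow> b t" by (rule tendsto_eventually)
  qed
  moreover have "b \<in> {0..} \<rightarrow>\<^sub>E mixed_actions"
    using a by (auto simp: b_def controls_def)
  ultimately show ?thesis using that eq by (auto simp: controls_def)
qed

lemma ex1_play_path:
  fixes \<sigma>1 :: "'b::finite control \<Rightarrow> 'a::finite control" and \<sigma>2 :: "'a control \<Rightarrow> 'b control"
  assumes "\<sigma>1 \<in> strategies" "\<sigma>2 \<in> strategies"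
  shows "\<exists>!a. is_play_path \<sigma>1 \<sigma>2 a"
proof -
  obtain \<tau> :: "nat \<Rightarrow> real" where *: "\<tau> 0 = 0 \<and> strict_mono \<tau> \<and> filterlim \<tau> at_top sequentially \<and>
    (\<forall>a\<in>controls. \<forall>a'\<in>controls. \<forall>k.
       (\<forall>s\<in>{0..<\<tau> k}. a s = a' s) \<longrightarrow> (\<forall>t\<in>{0..<\<tau> (Suc k)}. \<sigma>1 a t = \<sigma>1 a' t))"
    using strategies_delay[OF assms(1)] by (rule exE)
  note \<tau> = *[THEN conjunct1] *[THEN conjunct2, THEN conjunct1]
    *[THEN conjunct2, THEN conjunct2, THEN conjunct1]
  note d = *[THEN conjunct2, THEN conjunct2, THEN conjunct2, THEN bspec, THEN bspec,
      THEN spec, THEN mp, THEN bspec]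
  define F where "F = (\<lambda>a. \<sigma>1 (\<sigma>2 a))"
  have FC: "F a \<in> controls" if "a \<in> controls" for a
    using that assms by (simp add: F_def strategies_imp_controls)
  have F: "F a t = F a' t"
    if "a \<in> controls" "a' \<in> controls" "\<forall>s\<in>{0..<\<tau> k}. a s = a' s" "t \<in> {0..<\<tau> (Suc k)}" for a a' k t
    unfolding F_def
  proof (rule d)
    show "\<forall>s\<in>{0..<\<tau> k}. \<sigma>2 a s = \<sigma>2 a' s"
      using strategies_causal[OF assms(2) that(1,2,3)] by blast
  qed (use that assms strategies_imp_controls in auto)
  have uniq: "a = a'" if "a \<in> controls" "a' \<in> controls" "F a = a" "F a' = a'" for a a'
  proof (rule controls_eqI)
    have ag: "\<forall>s\<in>{0..<\<tau> n}. a s = a' s" for n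
    proof (induction n)
      case (Suc n)
      then show ?case using F[of a a' n] that by simp
    qed (simp add: \<tau>)
    fix t :: real assume t: "t \<ge> 0"
    obtain k where "t < \<tau> (Suc k)" using delay_sequence[OF \<tau> t] by blast
    then show "a t = a' t" using ag[of "Suc k"] t by simp
  qed (use that in auto)
  obtain c :: "'a control" where c: "c \<in> controls" using controls_nonempty by blast
  define a where "a n = (F ^^ n) c" for n
  have aS: "a (Suc n) = F (a n)" for n by (simp add: a_def)
  have aC: "a n \<in> controls" for n by (induction n) (auto simp: a_def c FC)
  have ag: "\<forall>t\<in>{0..<\<tau> n}. a n t = a (Suc n) t" for n
  proof (induction n)
    case (Suc n)
    then show ?case using F[OF aC aC Suc] by (auto simp: aS)
  qed (simp add: \<tau>)
  obtain b where b: "b \<in> controls" and ba: "\<And>n t. t \<in> {0..<\<tau> n} \<Longrightarrow> b t = a n t"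
    by (rule controls_glue[of a \<tau>]) (use aC \<tau> ag in auto)
  have Fb: "F b = b"
  proof (rule controls_eqI)
    fix t :: real assume t: "t \<ge> 0"
    obtain k where k: "t < \<tau> (Suc k)" using delay_sequence[OF \<tau> t] by blast
    then have "F b t = a (Suc k) t" using F[OF b aC[of k], of k t] ba[of _ k] t by (simp add: aS)
    then show "F b t = b t" using ba[of t "Suc k"] k t by simp
  qed (use b FC in auto)
  show ?thesis
  proof (rule ex1I[of _ "(b, \<sigma>2 b)"])
    show "is_play_path \<sigma>1 \<sigma>2 (b, \<sigma>2 b)"
      using b Fb assms by (simp add: is_play_path_def F_def strategies_imp_controls)
    fix z assume z: "is_play_path \<sigma>1 \<sigma>2 z"
    then have z': "fst z \<in> controls" "\<sigma>1 (snd z) = fst z" "\<sigma>2 (fst z) = snd z"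
      by (simp_all add: is_play_path_def)
    have "F (fst z) = fst z" unfolding F_def z'(3) by (rule z'(2))
    then have "fst z = b" using uniq[OF z'(1) b _ Fb] by simp
    then show "z = (b, \<sigma>2 b)" using z'(3) by (simp add: prod_eq_iff)
  qed
qed

end

theory Submission
  imports Defs
begin

text \<open>Attainability of \<open>0\<close> gives approachability because dividing by a time \<open>t \<ge> 1\<close> does not
  increase a norm (\<open>attainable_imp_approachable\<close>).

  If some projected game has a negative value, then by the minimax theorem Player 2 has a mixed
  action \<open>q\<close> that pushes the payoff in the direction \<open>l\<close> below a negative number \<open>v\<close>, whatever
  Player 1 does. When Player 2 plays \<open>q\<close> forever, the average payoff stays in the half-space
  \<open>l \<bullet> x \<le> v\<close>, which is at a positive distance from \<open>0\<close>; so \<open>0\<close> is not approachable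
  (\<open>approachable_imp_game_value_nonneg\<close>).

  If all projected games have a nonnegative value, then Player 1 runs Blackwell's strategy on
  shrinking blocks of time. At the start of block \<open>n\<close>, of length \<open>\<delta> n\<close>, Player 1 looks at
  the cumulative payoff \<open>x\<close> and plays throughout the block an action that is good in the
  direction \<open>- x\<close>. The payoff collected in the block then has essentially no positive component
  along \<open>x\<close>, and by Pythagoras the squared norm of the cumulative payoff grows by at most a constant
  times \<open>(\<delta> n)\<^sup>2\<close>. The lengths \<open>\<delta> n = c / (n + 1)\<close> have an infinite sum, so the blocks cover
  all times, but the sum of their squares is as small as desired when \<open>c\<close> is small. Hence the
  cumulative payoff stays within any prescribed distance of \<open>0\<close> at all times
  (\<open>norm_cumulative_payoff_block_strategy_le\<close>, \<open>game_value_nonneg_imp_attainable\<close>). It is the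
  cumulative payoff that stays small, and not merely the average, because in continuous time the
  stages may be made arbitrarily short.\<close>

section \<open>Mixed payoffs and their integrals\<close>

text \<open>A crude common bound on the norms of all mixed payoffs; any such bound serves, as only the
  constant in front of \<open>(\<delta> n)\<^sup>2\<close> depends on it.\<close>

definition payoff_bound :: "('a::finite \<Rightarrow> 'b::finite \<Rightarrow> real ^ 'm::finite) \<Rightarrow> real" where
  "payoff_bound u = (\<Sum>i\<in>UNIV. \<Sum>j\<in>UNIV. norm (u i j))"

lemma payoff_bound_nonneg: "payoff_bound u \<ge> 0"
  by (simp add: payoff_bound_def sum_nonneg)

lemma mixed_action_le_1:
  assumes "p \<in> mixed_actions"
  shows "p $ i \<le> 1"
proof -
  have "p $ i \<le> (\<Sum>i\<in>UNIV. p $ i)"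
    using assms by (intro member_le_sum) (auto simp: mixed_actions_def)
  then show ?thesis using assms by (simp add: mixed_actions_def)
qed

lemma axis_mixed_action: "axis j 1 \<in> mixed_actions"
  by (auto simp: mixed_actions_def axis_def)

lemma norm_mixed_payoff_le:
  assumes "p \<in> mixed_actions" "q \<in> mixed_actions"
  shows "norm (mixed_payoff u p q) \<le> payoff_bound u"
proof -
  have "norm ((p $ i * q $ j) *\<^sub>R u i j) \<le> norm (u i j)" for i j
  proof -
    have "\<bar>p $ i * q $ j\<bar> \<le> 1"
      using assms mixed_action_le_1[OF assms(1), of i] mixed_action_le_1[OF assms(2), of j]
      by (simp add: mixed_actions_def abs_mult mult_le_one)
    then show ?thesis by (simp add: mult_left_le_one_le)
  qed
  then show ?thesis unfolding mixed_payoff_def payoff_bound_def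
    by (intro sum_norm_le)
qed

lemma inner_mixed_payoff_le:
  assumes "p \<in> mixed_actions" "q \<in> mixed_actions"
  shows "\<bar>l \<bullet> mixed_payoff u p q\<bar> \<le> norm l * payoff_bound u"
  by (meson Cauchy_Schwarz_ineq2 assms mult_left_mono norm_ge_zero norm_mixed_payoff_le order_trans)

text \<open>By linearity in the action of Player 2, that player's pure actions determine everything; this
  turns the minimax argument into one about vectors indexed by pure actions.\<close>

lemma inner_mixed_payoff_expand:
  "l \<bullet> mixed_payoff u p q = (\<Sum>j\<in>UNIV. q $ j * (l \<bullet> mixed_payoff u p (axis j 1)))"
proof -
  have *: "mixed_payoff u p (axis j 1) = (\<Sum>i\<in>UNIV. p $ i *\<^sub>R u i j)" for j
  proof -
    have "(\<Sum>k\<in>UNIV. (p $ i * axis j 1 $ k) *\<^sub>R u i k) = p $ i *\<^sub>R u i j" for i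
      by (subst sum.remove[of _ j]) (auto simp: axis_def intro!: sum.neutral)
    then show ?thesis by (simp add: mixed_payoff_def)
  qed
  have "mixed_payoff u p q = (\<Sum>j\<in>UNIV. q $ j *\<^sub>R mixed_payoff u p (axis j 1))"
    unfolding * mixed_payoff_def[of u p q]
    by (subst sum.swap) (simp add: scaleR_sum_right mult.commute)
  then show ?thesis by (simp add: inner_sum_right)
qed

text \<open>Controls are measurable on \<open>[0,\<infinity>)\<close> alone. The integrand is therefore first cut off at
  negative times to obtain a function that is measurable on the whole line; on \<open>A\<close> this changes
  nothing.\<close>

lemma set_integrable_mixed_payoff:
  assumes "a \<in> controls" "b \<in> controls" "A \<in> sets lebesgue" "A \<subseteq> {0..t}"
  shows "set_integrable lebesgue A (\<lambda>s. mixed_payoff u (a s) (b s))"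
proof -
  let ?g = "\<lambda>s. mixed_payoff u (a s) (b s)"
  have a: "a \<in> lebesgue_on {0..} \<rightarrow>\<^sub>M borel" and b: "b \<in> lebesgue_on {0..} \<rightarrow>\<^sub>M borel"
    using assms by (auto simp: controls_def)
  have [measurable]: "(\<lambda>s. a s $ i) \<in> lebesgue_on {0..} \<rightarrow>\<^sub>M borel"
    "(\<lambda>s. b s $ j) \<in> lebesgue_on {0..} \<rightarrow>\<^sub>M borel" for i j
    using borel_measurable_continuous_onI[of "\<lambda>x. x $ i"] borel_measurable_continuous_onI[of "\<lambda>x. x $ j"]
    by (auto intro!: measurable_compose[OF a] measurable_compose[OF b] continuous_intros)
  have "?g \<in> lebesgue_on {0..} \<rightarrow>\<^sub>M borel"
    unfolding mixed_payoff_def by measurable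
  then have "(\<lambda>s. indicator {0..} s *\<^sub>R ?g s) \<in> lebesgue \<rightarrow>\<^sub>M borel"
    by (simp add: borel_measurable_restrict_space_iff)
  moreover have "emeasure lebesgue A < \<infinity>"
    using bounded_set_imp_lmeasurable[OF bounded_subset[OF bounded_closed_interval assms(4)] assms(3)]
    unfolding fmeasurable_def infinity_ennreal_def by blast
  moreover have "norm (indicator {0..} s *\<^sub>R ?g s) \<le> payoff_bound u" if "s \<in> A" for s
  proof -
    have "s \<ge> 0" using that assms(4) by auto
    then show ?thesis
      using assms(1,2) norm_mixed_payoff_le[of "a s" "b s" u] by (auto simp: controls_def)
  qed
  ultimately have "integrable lebesgue (\<lambda>s. indicator A s *\<^sub>R (indicator {0..} s *\<^sub>R ?g s))"
    using assms(3) by (intro integrableI_bounded_set_indicator[where B = "payoff_bound u"]) auto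
  also have "(\<lambda>s. indicator A s *\<^sub>R (indicator {0..} s *\<^sub>R ?g s)) = (\<lambda>s. indicator A s *\<^sub>R ?g s)"
    using assms(4) by (fastforce simp: indicator_def)
  finally show ?thesis by (simp add: set_integrable_def)
qed

lemma set_integral_le_const:
  fixes f :: "'c \<Rightarrow> real"
  assumes "set_integrable M A f" "A \<in> sets M" "emeasure M A < \<infinity>" "\<And>s. s \<in> A \<Longrightarrow> f s \<le> c"
  shows "(LINT s:A|M. f s) \<le> c * measure M A"
proof -
  have "(LINT s:A|M. f s) \<le> (LINT s:A|M. c)"
    using assms by (intro set_integral_mono) (auto simp: set_integrable_def)
  also have "\<dots> = c * measure M A"
    using assms by (simp add: set_integral_const)
  finally show ?thesis .
qed

lemma inner_integral_mixed_payoff_le: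
  assumes "a \<in> controls" "b \<in> controls" "A \<in> sets lebesgue" "A \<subseteq> {0..t}"
    and "\<And>s. s \<in> A \<Longrightarrow> l \<bullet> mixed_payoff u (a s) (b s) \<le> c"
  shows "l \<bullet> (LINT s:A|lebesgue. mixed_payoff u (a s) (b s)) \<le> c * measure lebesgue A"
proof -
  let ?g = "\<lambda>s. mixed_payoff u (a s) (b s)"
  have i: "set_integrable lebesgue A ?g" by (rule set_integrable_mixed_payoff) fact+
  have fin: "emeasure lebesgue A < \<infinity>"
    using bounded_set_imp_lmeasurable[OF bounded_subset[OF bounded_closed_interval assms(4)] assms(3)]
    unfolding fmeasurable_def infinity_ennreal_def by blast
  have i': "set_integrable lebesgue A (\<lambda>s. l \<bullet> ?g s)"
    using integrable_inner_right[of l, OF i[unfolded set_integrable_def]]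
    by (simp add: set_integrable_def)
  have "l \<bullet> (LINT s:A|lebesgue. ?g s) = (LINT s:A|lebesgue. l \<bullet> ?g s)"
    using integral_inner_right[of l, OF i[unfolded set_integrable_def]]
    by (simp add: set_lebesgue_integral_def)
  also have "\<dots> \<le> c * measure lebesgue A"
    by (rule set_integral_le_const[OF i']) (use assms fin in auto)
  finally show ?thesis .
qed

text \<open>The norm of the integral is its inner product with its own direction, so the preceding bound
  on components applies.\<close>

lemma norm_integral_mixed_payoff_le:
  assumes "a \<in> controls" "b \<in> controls" "A \<in> sets lebesgue" "A \<subseteq> {0..t}"
  shows "norm (LINT s:A|lebesgue. mixed_payoff u (a s) (b s)) \<le> payoff_bound u * measure lebesgue A"
proof -
  define I where "I = (LINT s:A|lebesgue. mixed_payoff u (a s) (b s))"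
  have "sgn I \<bullet> I \<le> payoff_bound u * measure lebesgue A"
    unfolding I_def
  proof (rule inner_integral_mixed_payoff_le[OF assms])
    fix s assume "s \<in> A"
    then have "s \<ge> 0" using assms(4) by auto
    then have "a s \<in> mixed_actions" "b s \<in> mixed_actions"
      using assms(1,2) by (auto simp: controls_def)
    note inner_mixed_payoff_le[OF this, of "sgn I" u]
    then show "sgn (LINT s:A|lebesgue. mixed_payoff u (a s) (b s)) \<bullet> mixed_payoff u (a s) (b s) \<le> payoff_bound u"
      using payoff_bound_nonneg[of u] by (simp add: norm_sgn I_def split: if_splits)
  qed
  moreover have "sgn I \<bullet> I = norm I"
    by (cases "I = 0") (simp_all add: sgn_div_norm dot_square_norm power2_eq_square)
  ultimately show ?thesis by (simp add: I_def)
qed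

lemma const_control:
  assumes "p \<in> mixed_actions"
  shows "(\<lambda>t\<in>{0..}. p) \<in> controls"
proof -
  have "(\<lambda>t\<in>{0..}. p) \<in> lebesgue_on {0..} \<rightarrow>\<^sub>M borel"
    by (subst measurable_cong[of _ _ "\<lambda>_. p"]) auto
  then show ?thesis using assms by (auto simp: controls_def)
qed

lemma const_strategy:
  assumes "b \<in> controls"
  shows "(\<lambda>_. b) \<in> strategies"
  unfolding strategies_def using assms
  by (auto intro!: exI[of _ real] strict_monoI filterlim_real_sequentially)

lemma play_path_props:
  assumes "\<sigma>1 \<in> strategies" "\<sigma>2 \<in> strategies"
  obtains a b where "play_path \<sigma>1 \<sigma>2 = (a, b)" "a \<in> controls" "b \<in> controls" "\<sigma>1 b = a" "\<sigma>2 a = b"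
proof -
  have "is_play_path \<sigma>1 \<sigma>2 (play_path \<sigma>1 \<sigma>2)"
    unfolding play_path_def by (rule theI'[OF ex1_play_path[OF assms]])
  then show ?thesis using that[of "fst (play_path \<sigma>1 \<sigma>2)" "snd (play_path \<sigma>1 \<sigma>2)"]
    by (simp add: is_play_path_def)
qed

section \<open>The value of a projected game\<close>

lemma bdd_below_inner_mixed_payoff:
  assumes "p \<in> mixed_actions"
  shows "bdd_below ((\<lambda>q. l \<bullet> mixed_payoff u p q) ` mixed_actions)"
proof (rule bdd_belowI2)
  fix q :: "real ^ 'b" assume "q \<in> mixed_actions"
  then show "- (norm l * payoff_bound u) \<le> l \<bullet> mixed_payoff u p q"
    using inner_mixed_payoff_le[OF assms, of q l u] by linarith
qed

lemma bdd_above_INF_mixed_payoff: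
  "bdd_above ((\<lambda>p. INF q\<in>mixed_actions. l \<bullet> mixed_payoff u p q) ` mixed_actions)"
proof (rule bdd_aboveI2)
  fix p :: "real ^ 'a" assume p: "p \<in> mixed_actions"
  have "(INF q\<in>mixed_actions. l \<bullet> mixed_payoff u p q) \<le> l \<bullet> mixed_payoff u p (axis undefined 1)"
    by (rule cINF_lower[OF bdd_below_inner_mixed_payoff[OF p] axis_mixed_action])
  also have "\<dots> \<le> norm l * payoff_bound u"
    using inner_mixed_payoff_le[OF p axis_mixed_action, of l u undefined] by linarith
  finally show "(INF q\<in>mixed_actions. l \<bullet> mixed_payoff u p q) \<le> norm l * payoff_bound u" .
qed

text \<open>An action that is optimal up to \<open>e\<close> comes directly from the supremum in the value. It can
  replace an optimal one: with \<open>e = \<delta> n\<close>, the error accumulated over a block of length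
  \<open>\<delta> n\<close> is of the order \<open>(\<delta> n)\<^sup>2\<close>, the same as the unavoidable growth.\<close>

lemma near_optimal_action:
  assumes "game_value u l \<ge> 0" "e > 0"
  obtains p where "p \<in> mixed_actions" "\<And>q. q \<in> mixed_actions \<Longrightarrow> l \<bullet> mixed_payoff u p q \<ge> - e"
proof -
  have "- e < game_value u l" using assms by simp
  then obtain p where p: "p \<in> mixed_actions" "- e < (INF q\<in>mixed_actions. l \<bullet> mixed_payoff u p q)"
    using less_cSUP_iff[OF _ bdd_above_INF_mixed_payoff[of l u], of "- e"] axis_mixed_action
    unfolding game_value_def by blast
  have "- e \<le> l \<bullet> mixed_payoff u p q" if "q \<in> mixed_actions" for q
    using cINF_lower[OF bdd_below_inner_mixed_payoff[OF p(1)] that, of l u] p(2) by linarith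
  then show ?thesis using that p by blast
qed

text \<open>The half of von Neumann's minimax theorem that produces an action of Player 2. Map every
  mixed action of Player 1 to its row of payoffs against the pure actions of Player 2. If all
  entries of some row exceeded \<open>v\<close>, that action would guarantee \<open>v\<close> to Player 1, against the
  assumption. So the convex set of rows misses the open orthant above \<open>(v, \<dots>, v)\<close>, and the
  normal vector of a separating hyperplane, rescaled to total mass \<open>1\<close>, is the required action.\<close>

lemma minimax_response:
  fixes u :: "'a::finite \<Rightarrow> 'b::finite \<Rightarrow> real ^ 'm::finite"
  assumes "game_value u l < v"
  obtains q where "q \<in> mixed_actions" "\<And>p. p \<in> mixed_actions \<Longrightarrow> l \<bullet> mixed_payoff u p q \<le> v"
proof -
  define row :: "real ^ 'a \<Rightarrow> real ^ 'b" where
    "row p = (\<chi> j. l \<bullet> mixed_payoff u p (axis j 1))" for p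
  have expand: "l \<bullet> mixed_payoff u p q = q \<bullet> row p" for p q
    by (subst inner_mixed_payoff_expand) (simp add: row_def inner_vec_def)
  have lin: "linear row"
    by (rule linearI)
       (simp_all add: row_def vec_eq_iff mixed_payoff_def inner_sum_right algebra_simps
          sum.distrib sum_distrib_left)
  let ?S = "row ` mixed_actions" and ?U = "{x :: real ^ 'b. \<forall>j. v < x $ j}"
  have "convex (mixed_actions :: (real ^ 'a) set)"
    unfolding convex_def by (auto simp: mixed_actions_def sum.distrib sum_distrib_left[symmetric])
  then have S: "convex ?S" by (rule convex_linear_image[OF lin])
  have U: "convex ?U"
    unfolding convex_def
  proof (clarsimp)
    fix x y :: "real ^ 'b" and a b :: real and j
    assume h: "\<forall>j. v < x $ j" "\<forall>j. v < y $ j" "0 \<le> a" "0 \<le> b" "a + b = 1"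
    show "v < a * x $ j + b * y $ j"
      using convex_bound_lt[of "- (x $ j)" "- v" "- (y $ j)" a b] h by simp
  qed
  have neS: "?S \<noteq> {}" using axis_mixed_action by blast
  have Uin: "(\<chi> j. v + 1) \<in> ?U" by simp
  have disj: "?S \<inter> ?U = {}"
  proof (rule ccontr)
    assume "?S \<inter> ?U \<noteq> {}"
    then obtain p where p: "p \<in> mixed_actions" "\<And>j. v < row p $ j" by blast
    have "v \<le> l \<bullet> mixed_payoff u p q" if q: "q \<in> mixed_actions" for q
    proof -
      have "v = (\<Sum>j\<in>UNIV. q $ j * v)"
        using q by (simp add: mixed_actions_def flip: sum_distrib_right)
      also have "\<dots> \<le> (\<Sum>j\<in>UNIV. q $ j * row p $ j)"
        using q p(2) by (intro sum_mono mult_left_mono) (auto simp: mixed_actions_def less_imp_le)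
      finally show ?thesis unfolding expand by (simp add: inner_vec_def)
    qed
    then have "v \<le> (INF q\<in>mixed_actions. l \<bullet> mixed_payoff u p q)"
      using axis_mixed_action by (intro cINF_greatest) blast+
    also have "\<dots> \<le> game_value u l"
      unfolding game_value_def by (rule cSUP_upper[OF p(1) bdd_above_INF_mixed_payoff])
    finally show False using assms by simp
  qed
  obtain w c where w: "w \<noteq> 0" "\<forall>x\<in>?S. w \<bullet> x \<le> c" "\<forall>x\<in>?U. w \<bullet> x \<ge> c"
    using separating_hyperplane_sets[OF S U neS _ disj] Uin by blast
  \<comment> \<open>A negative entry of the normal would let \<open>w \<bullet> x\<close> drop below \<open>c\<close> far out in the orthant,
    which is unbounded in every coordinate direction.\<close>
  have w0: "w $ j \<ge> 0" for j
  proof (rule ccontr)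
    assume n: "\<not> w $ j \<ge> 0"
    define z where "z = w \<bullet> (\<chi> j. v + 1)"
    define K where "K = (\<bar>z - c\<bar> + 1) / (- w $ j)"
    have K: "K \<ge> 0" using n unfolding K_def by (intro divide_nonneg_nonneg) auto
    have "(\<chi> j. v + 1) + K *\<^sub>R axis j 1 \<in> ?U"
      using K by (auto simp: axis_def intro: add_strict_increasing2)
    then have "c \<le> w \<bullet> ((\<chi> j. v + 1) + K *\<^sub>R axis j 1)" using w by blast
    also have "\<dots> = z + K * w $ j"
      by (simp add: z_def inner_add_right inner_axis)
    also have "K * w $ j = - (\<bar>z - c\<bar> + 1)" using n by (simp add: K_def)
    finally show False by linarith
  qed
  define W where "W = (\<Sum>j\<in>UNIV. w $ j)"
  have W: "W > 0"
  proof -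
    have "W \<ge> 0" unfolding W_def by (intro sum_nonneg w0)
    moreover have "W \<noteq> 0"
      using w(1) w0 by (auto simp: W_def sum_nonneg_eq_0_iff vec_eq_iff)
    ultimately show ?thesis by simp
  qed
  \<comment> \<open>The corner \<open>(v, \<dots>, v)\<close> is not in the orthant but is a limit of points on its diagonal.\<close>
  have cv: "c \<le> v * W"
  proof (rule field_le_epsilon)
    fix e :: real assume e: "e > 0"
    have "(\<chi> j. v + e / W) \<in> ?U" using e W by simp
    then have "c \<le> w \<bullet> (\<chi> j. v + e / W)" using w by blast
    also have "\<dots> = (v + e / W) * W"
      by (simp add: inner_vec_def W_def sum_distrib_right[symmetric] mult.commute)
    also have "\<dots> = v * W + e" using W by (simp add: field_simps)
    finally show "c \<le> v * W + e" .
  qed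
  show ?thesis
  proof
    show "(1 / W) *\<^sub>R w \<in> mixed_actions"
      using w0 W by (auto simp: mixed_actions_def sum_divide_distrib[symmetric] W_def[symmetric])
    fix p :: "real ^ 'a" assume "p \<in> mixed_actions"
    then have "w \<bullet> row p \<le> v * W" using w(2) cv by force
    then show "l \<bullet> mixed_payoff u p ((1 / W) *\<^sub>R w) \<le> v"
      using W by (simp add: expand field_simps)
  qed
qed

lemma approachable_imp_game_value_nonneg:
  assumes "approachable u 0"
  shows "game_value u l \<ge> 0"
proof (rule ccontr)
  assume "\<not> game_value u l \<ge> 0"
  then obtain v where v: "game_value u l < v" "v < 0" using dense[of "game_value u l" 0] by auto
  obtain q where q: "q \<in> mixed_actions" "\<And>p. p \<in> mixed_actions \<Longrightarrow> l \<bullet> mixed_payoff u p q \<le> v"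
    by (rule minimax_response[OF v(1)]) blast
  \<comment> \<open>Within distance \<open>e\<close> of \<open>0\<close> the component along \<open>l\<close> exceeds \<open>v / 2\<close>; the summand \<open>1\<close>
    keeps the denominator positive.\<close>
  define e where "e = - v / (2 * (norm l + 1))"
  have e: "e > 0" unfolding e_def using v by (intro divide_pos_pos) (auto simp: add_nonneg_pos)
  define b where "b = (\<lambda>t\<in>{0::real..}. q)"
  have b: "b \<in> controls" unfolding b_def by (rule const_control[OF q(1)])
  have b': "(\<lambda>_. b) \<in> strategies" by (rule const_strategy[OF b])
  obtain T \<sigma> where T: "T > 0" and \<sigma>: "\<sigma> \<in> strategies"
    and close: "infdist (average_payoff u \<sigma> (\<lambda>_. b) T) {0} \<le> e"
    using assms e b' unfolding approachable_def approachable_set_def by blast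
  obtain a where path: "play_path \<sigma> (\<lambda>_. b) = (a, b)" and a: "a \<in> controls"
    by (rule play_path_props[OF \<sigma> b']) blast
  have "l \<bullet> cumulative_payoff u \<sigma> (\<lambda>_. b) T \<le> v * measure lebesgue {0..T}"
    unfolding cumulative_payoff_def path fst_conv snd_conv
  proof (rule inner_integral_mixed_payoff_le[OF a b])
    fix s assume s: "s \<in> {0..T}"
    then have "a s \<in> mixed_actions" using a by (auto simp: controls_def)
    then show "l \<bullet> mixed_payoff u (a s) (b s) \<le> v" using q(2) s by (simp add: b_def)
  qed auto
  then have "l \<bullet> average_payoff u \<sigma> (\<lambda>_. b) T \<le> v"
    using T by (simp add: average_payoff_def field_simps)
  moreover have "\<bar>l \<bullet> average_payoff u \<sigma> (\<lambda>_. b) T\<bar> \<le> norm l * e"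
    using close
    by (intro order_trans[OF Cauchy_Schwarz_ineq2] mult_left_mono) auto
  moreover have "norm l * e < - v"
  proof -
    have "norm l * e \<le> (norm l + 1) * e" using e by simp
    also have "\<dots> = - v / 2" by (simp add: e_def field_simps add_nonneg_eq_0_iff)
    also have "\<dots> < - v" using v by simp
    finally show ?thesis .
  qed
  ultimately show False by linarith
qed

section \<open>Blackwell's strategy on blocks of time\<close>

text \<open>A strategy sees only the control \<open>b\<close> of the opponent and not its own past play. So the
  cumulative payoff at the block boundary \<open>\<tau> n\<close> is recomputed from \<open>b\<close>: in block \<open>n\<close> Player 1
  plays the constant action that the rule \<open>P n\<close> assigns to the payoff accumulated before.\<close>

primrec block_payoff ::
  "('a::finite \<Rightarrow> 'b::finite \<Rightarrow> real ^ 'm::finite) \<Rightarrow> (nat \<Rightarrow> real ^ 'm \<Rightarrow> real ^ 'a) \<Rightarrow> (nat \<Rightarrow> real)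
    \<Rightarrow> 'b control \<Rightarrow> nat \<Rightarrow> real ^ 'm" where
  "block_payoff u P \<tau> b 0 = 0"
| "block_payoff u P \<tau> b (Suc n) = block_payoff u P \<tau> b n +
     (LINT s:{\<tau> n..<\<tau> (Suc n)}|lebesgue. mixed_payoff u (P n (block_payoff u P \<tau> b n)) (b s))"

text \<open>The \<open>LEAST\<close> is the index of the block \<open>[\<tau> n, \<tau> (n + 1))\<close> that contains \<open>t\<close>.\<close>

definition block_strategy ::
  "('a::finite \<Rightarrow> 'b::finite \<Rightarrow> real ^ 'm::finite) \<Rightarrow> (nat \<Rightarrow> real ^ 'm \<Rightarrow> real ^ 'a) \<Rightarrow> (nat \<Rightarrow> real)
    \<Rightarrow> 'b control \<Rightarrow> 'a control" where
  "block_strategy u P \<tau> b = (\<lambda>t\<in>{0..}. let n = (LEAST n. t < \<tau> (Suc n)) in P n (block_payoff u P \<tau> b n))"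

lemma block_index:
  fixes \<tau> :: "nat \<Rightarrow> real"
  assumes "strict_mono \<tau>" "\<tau> n \<le> t" "t < \<tau> (Suc n)"
  shows "(LEAST n. t < \<tau> (Suc n)) = n"
proof (rule Least_equality)
  fix m assume "t < \<tau> (Suc m)"
  then have "\<tau> n < \<tau> (Suc m)" using assms by linarith
  then show "n \<le> m" using assms(1) by (simp add: strict_mono_less)
qed fact

lemma block_strategy_eq:
  fixes \<tau> :: "nat \<Rightarrow> real"
  assumes "strict_mono \<tau>" "\<tau> 0 = 0" "\<tau> n \<le> t" "t < \<tau> (Suc n)"
  shows "block_strategy u P \<tau> b t = P n (block_payoff u P \<tau> b n)"
proof -
  have "0 \<le> \<tau> n" using assms(1,2) by (metis le0 strict_mono_less_eq)
  then have "0 \<le> t" using assms by linarith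
  then show ?thesis using block_index[OF assms(1,3,4)] by (simp add: block_strategy_def)
qed

lemma block_strategy_in_controls:
  assumes "\<And>n x. P n x \<in> mixed_actions"
  shows "block_strategy u P \<tau> b \<in> controls"
proof -
  let ?f = "\<lambda>n. P n (block_payoff u P \<tau> b n)"
  have [measurable]: "(\<lambda>t. LEAST n. t < \<tau> (Suc n)) \<in> borel \<rightarrow>\<^sub>M count_space UNIV"
    by measurable
  have "(\<lambda>t. ?f (LEAST n. t < \<tau> (Suc n))) \<in> borel \<rightarrow>\<^sub>M borel"
    by measurable
  then have "(\<lambda>t. ?f (LEAST n. t < \<tau> (Suc n))) \<in> lebesgue \<rightarrow>\<^sub>M borel"
    by (simp add: measurable_completion)
  then have "(\<lambda>t. ?f (LEAST n. t < \<tau> (Suc n))) \<in> lebesgue_on {0..} \<rightarrow>\<^sub>M borel"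
    by (rule measurable_restrict_space1)
  then have "block_strategy u P \<tau> b \<in> lebesgue_on {0..} \<rightarrow>\<^sub>M borel"
    by (subst measurable_cong[of _ _ "\<lambda>t. ?f (LEAST n. t < \<tau> (Suc n))"])
       (auto simp: block_strategy_def Let_def)
  then show ?thesis
    using assms by (auto simp: controls_def block_strategy_def Let_def)
qed

text \<open>The integrals run over half-open blocks, so the value at \<open>\<tau> n\<close> itself, which the delay
  condition on strategies does not reveal, has no influence.\<close>

lemma block_payoff_causal:
  fixes \<tau> :: "nat \<Rightarrow> real"
  assumes "strict_mono \<tau>" "\<tau> 0 = 0" "\<And>s. s \<in> {0..<\<tau> n} \<Longrightarrow> b s = b' s"
  shows "block_payoff u P \<tau> b n = block_payoff u P \<tau> b' n"
  using assms(3)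
proof (induction n)
  case (Suc n)
  have n: "0 \<le> \<tau> n" "\<tau> n < \<tau> (Suc n)"
    using assms(1,2) by (metis le0 strict_mono_less_eq) (simp add: assms(1) strict_mono_less)
  then have "block_payoff u P \<tau> b n = block_payoff u P \<tau> b' n"
    using Suc by simp
  moreover have "(LINT s:{\<tau> n..<\<tau> (Suc n)}|lebesgue. mixed_payoff u p (b s)) =
      (LINT s:{\<tau> n..<\<tau> (Suc n)}|lebesgue. mixed_payoff u p (b' s))" for p
    using Suc.prems n by (intro set_lebesgue_integral_cong) auto
  ultimately show ?case by simp
qed simp

lemma block_strategy_in_strategies:
  fixes \<tau> :: "nat \<Rightarrow> real" and u :: "'a::finite \<Rightarrow> 'b::finite \<Rightarrow> real ^ 'm::finite"
  assumes "strict_mono \<tau>" "\<tau> 0 = 0" "filterlim \<tau> at_top sequentially" "\<And>n x. P n x \<in> mixed_actions"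
  shows "block_strategy u P \<tau> \<in> strategies"
  unfolding strategies_def mem_Collect_eq
proof (intro conjI exI[of _ \<tau>] ballI allI impI)
  show "block_strategy u P \<tau> \<in> controls \<rightarrow> controls"
    by (intro Pi_I block_strategy_in_controls assms)
  fix b b' :: "'b control" and k t
  assume "\<forall>s\<in>{0..<\<tau> k}. b s = b' s" and t: "t \<in> {\<tau> k..<\<tau> (Suc k)}"
  then have "block_payoff u P \<tau> b k = block_payoff u P \<tau> b' k"
    by (intro block_payoff_causal assms) auto
  then show "block_strategy u P \<tau> b t = block_strategy u P \<tau> b' t"
    using block_strategy_eq[OF assms(1,2), of k t u P b]
      block_strategy_eq[OF assms(1,2), of k t u P b'] t by simp
qed (use assms in auto)

text \<open>Blackwell's estimate for a piece of a block. If \<open>I\<close> is the payoff collected during a time of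
  at most \<open>d\<close>, then \<open>\<parallel>x + I\<parallel>\<^sup>2 = \<parallel>x\<parallel>\<^sup>2 + 2 (x \<bullet> I) + \<parallel>I\<parallel>\<^sup>2\<close>, where \<open>x \<bullet> I \<le> d\<^sup>2\<close> as the component
  along \<open>x\<close> grows at a rate of at most \<open>d\<close>, and \<open>\<parallel>I\<parallel>\<close> is at most \<open>d\<close> times the payoff bound.\<close>

lemma norm_step_le:
  assumes "a \<in> controls" "b \<in> controls" "A \<in> sets lebesgue" "A \<subseteq> {0..t}"
    and "\<And>s. s \<in> A \<Longrightarrow> x \<bullet> mixed_payoff u (a s) (b s) \<le> d" "measure lebesgue A \<le> d"
  shows "(norm (x + (LINT s:A|lebesgue. mixed_payoff u (a s) (b s))))\<^sup>2
    \<le> (norm x)\<^sup>2 + (2 + (payoff_bound u)\<^sup>2) * d\<^sup>2"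
proof -
  define I where "I = (LINT s:A|lebesgue. mixed_payoff u (a s) (b s))"
  have d: "d \<ge> 0" using assms(6) measure_nonneg order_trans by blast
  have "x \<bullet> I \<le> d * measure lebesgue A"
    unfolding I_def by (rule inner_integral_mixed_payoff_le[OF assms(1-5)])
  also have "\<dots> \<le> d\<^sup>2" using assms(6) d by (simp add: power2_eq_square mult_left_mono)
  finally have 1: "x \<bullet> I \<le> d\<^sup>2" .
  have "norm I \<le> payoff_bound u * measure lebesgue A"
    unfolding I_def by (rule norm_integral_mixed_payoff_le[OF assms(1-4)])
  also have "\<dots> \<le> payoff_bound u * d"
    using assms(6) payoff_bound_nonneg by (rule mult_left_mono)
  finally have "(norm I)\<^sup>2 \<le> (payoff_bound u * d)\<^sup>2" by (rule power_mono) simp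
  then have 2: "(norm I)\<^sup>2 \<le> (payoff_bound u)\<^sup>2 * d\<^sup>2" by (simp add: power_mult_distrib)
  have "(norm (x + I))\<^sup>2 = (norm x)\<^sup>2 + 2 * (x \<bullet> I) + (norm I)\<^sup>2"
    by (simp add: power2_norm_eq_inner inner_add_left inner_add_right inner_commute)
  then show ?thesis using 1 2 by (simp add: I_def[symmetric] algebra_simps)
qed

text \<open>Along the play path the values of \<open>block_payoff\<close> are the true cumulative payoffs at the block
  boundaries, so the step estimate can be summed over the complete blocks. A last step, for the part
  of the current block up to \<open>t\<close>, covers times between boundaries.\<close>

lemma norm_cumulative_payoff_block_strategy_le:
  fixes \<tau> \<delta> :: "nat \<Rightarrow> real"
  assumes \<tau>: "strict_mono \<tau>" "\<tau> 0 = 0" "filterlim \<tau> at_top sequentially"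
    and \<delta>: "\<And>n. \<tau> (Suc n) - \<tau> n = \<delta> n"
    and P: "\<And>n x. P n x \<in> mixed_actions"
      "\<And>n x q. q \<in> mixed_actions \<Longrightarrow> x \<bullet> mixed_payoff u (P n x) q \<le> \<delta> n"
    and \<sigma>2: "\<sigma>2 \<in> strategies" and t: "t \<ge> 0"
  shows "\<exists>n. (norm (cumulative_payoff u (block_strategy u P \<tau>) \<sigma>2 t))\<^sup>2
    \<le> (2 + (payoff_bound u)\<^sup>2) * (\<Sum>k<n. (\<delta> k)\<^sup>2)"
proof -
  obtain a b where path: "play_path (block_strategy u P \<tau>) \<sigma>2 = (a, b)"
    and a: "a \<in> controls" and b: "b \<in> controls" and ab: "block_strategy u P \<tau> b = a"
    by (rule play_path_props[OF block_strategy_in_strategies[of \<tau> P u] \<sigma>2]) (use \<tau> P(1) in auto)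
  define x where "x = block_payoff u P \<tau> b"
  let ?g = "\<lambda>s. mixed_payoff u (a s) (b s)"
  have \<tau>0: "0 \<le> \<tau> n" for n using \<tau>(1,2) by (metis le0 strict_mono_less_eq)
  have \<tau>S: "\<tau> n < \<tau> (Suc n)" for n by (simp add: \<tau>(1) strict_mono_less)
  have a_eq: "a s = P n (x n)" if "s \<in> {\<tau> n..<\<tau> (Suc n)}" for s n
    using block_strategy_eq[OF \<tau>(1,2), of n s u P b] that by (simp add: ab x_def)
  have b_mix: "b s \<in> mixed_actions" if "s \<ge> 0" for s using b that by (auto simp: controls_def)
  have xS: "x (Suc n) = x n + (LINT s:{\<tau> n..<\<tau> (Suc n)}|lebesgue. ?g s)" for n
    using a_eq by (auto simp: x_def intro!: set_lebesgue_integral_cong)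
  have split: "(LINT s:{0..<r} \<union> A|lebesgue. ?g s) =
      (LINT s:{0..<r}|lebesgue. ?g s) + (LINT s:A|lebesgue. ?g s)"
    if "A \<in> sets lebesgue" "A \<subseteq> {r..w}" "0 \<le> r" for A and r w :: real
    using that by (intro set_integral_Un set_integrable_mixed_payoff[OF a b, of _ "max r w"]) auto
  have x_int: "x n = (LINT s:{0..<\<tau> n}|lebesgue. ?g s)" for n
  proof (induction n)
    case 0
    show ?case by (simp add: x_def \<tau>(2) set_lebesgue_integral_def)
  next
    case (Suc n)
    have "{0..<\<tau> (Suc n)} = {0..<\<tau> n} \<union> {\<tau> n..<\<tau> (Suc n)}" using \<tau>0[of n] \<tau>S[of n] by auto
    moreover have "{\<tau> n..<\<tau> (Suc n)} \<subseteq> {\<tau> n..\<tau> (Suc n)}" by auto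
    ultimately show ?case
      using split[of "{\<tau> n..<\<tau> (Suc n)}" "\<tau> n" "\<tau> (Suc n)"] \<tau>0 Suc xS[of n] by simp
  qed
  have step: "(norm (x n + (LINT s:A|lebesgue. ?g s)))\<^sup>2
      \<le> (norm (x n))\<^sup>2 + (2 + (payoff_bound u)\<^sup>2) * (\<delta> n)\<^sup>2"
    if A: "A \<in> sets lebesgue" "A \<subseteq> {\<tau> n..<\<tau> (Suc n)}" for A n
  proof (rule norm_step_le[OF a b A(1)])
    show "A \<subseteq> {0..\<tau> (Suc n)}" using A(2) \<tau>0[of n] by force
    fix s assume "s \<in> A"
    then have s: "s \<in> {\<tau> n..<\<tau> (Suc n)}" "s \<ge> 0" using A(2) \<tau>0[of n] by force+
    show "x n \<bullet> ?g s \<le> \<delta> n"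
      unfolding a_eq[OF s(1)] by (rule P(2)[OF b_mix[OF s(2)]])
  next
    have "measure lebesgue A \<le> measure lebesgue {\<tau> n..<\<tau> (Suc n)}"
      using A by (intro measure_mono_fmeasurable bounded_set_imp_lmeasurable) auto
    then show "measure lebesgue A \<le> \<delta> n" using \<delta>[of n] \<tau>S[of n] by simp
  qed
  have bound: "(norm (x n))\<^sup>2 \<le> (2 + (payoff_bound u)\<^sup>2) * (\<Sum>k<n. (\<delta> k)\<^sup>2)" for n
  proof (induction n)
    case 0
    show ?case by (simp add: x_def)
  next
    case (Suc n)
    show ?case using step[of "{\<tau> n..<\<tau> (Suc n)}" n] Suc
      by (simp add: xS distrib_left)
  qed
  obtain n where n: "\<tau> n \<le> t" "t < \<tau> (Suc n)" by (rule delay_sequence[OF \<tau>(2,1,3) t])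
  have "{0..t} = {0..<\<tau> n} \<union> {\<tau> n..t}" using n \<tau>0[of n] by auto
  then have "cumulative_payoff u (block_strategy u P \<tau>) \<sigma>2 t = x n + (LINT s:{\<tau> n..t}|lebesgue. ?g s)"
    using split[of "{\<tau> n..t}" "\<tau> n" t] \<tau>0 by (simp add: cumulative_payoff_def path x_int)
  moreover have "{\<tau> n..t} \<subseteq> {\<tau> n..<\<tau> (Suc n)}" using n by auto
  ultimately have "(norm (cumulative_payoff u (block_strategy u P \<tau>) \<sigma>2 t))\<^sup>2
      \<le> (2 + (payoff_bound u)\<^sup>2) * (\<Sum>k<Suc n. (\<delta> k)\<^sup>2)"
    using step[of "{\<tau> n..t}" n] bound[of n] by (simp add: distrib_left)
  then show ?thesis by blast
qed

text \<open>The estimate holds from time \<open>0\<close> on, so the time in the definition of attainability is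
  arbitrary; \<open>1\<close> is chosen.\<close>

lemma game_value_nonneg_imp_attainable:
  fixes u :: "'a::finite \<Rightarrow> 'b::finite \<Rightarrow> real ^ 'm::finite"
  assumes "\<And>l. game_value u l \<ge> 0"
  shows "attainable u 0"
proof -
  define C where "C = 2 + (payoff_bound u)\<^sup>2"
  have C: "C > 0" by (simp add: C_def add_pos_nonneg)
  have "\<exists>\<sigma>1\<in>strategies. \<forall>t\<ge>1. \<forall>\<sigma>2\<in>strategies.
      infdist (cumulative_payoff u \<sigma>1 \<sigma>2 t) {0} \<le> e" if e: "e > 0" for e
  proof -
    have sm: "summable (\<lambda>k. 1 / (real k + 1)\<^sup>2)"
      using summable_Suc_iff[of "\<lambda>k. 1 / (real k)\<^sup>2"] inverse_power_summable[of 2, where 'a = real]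
      by (simp add: inverse_eq_divide add.commute)
    define Z where "Z = (\<Sum>k. 1 / (real k + 1)\<^sup>2)"
    have "0 \<le> Z" unfolding Z_def by (rule suminf_nonneg[OF sm]) simp
    \<comment> \<open>This scale makes the total growth \<open>C * (\<Sum>k. (\<delta> k)\<^sup>2) = C * c\<^sup>2 * Z\<close> at most \<open>e\<^sup>2\<close>;
      \<open>Z + 1\<close> instead of \<open>Z\<close> makes it evident that the division is by a positive number.\<close>
    define c where "c = e / sqrt (C * (Z + 1))"
    have pos: "C * (Z + 1) > 0" using C \<open>0 \<le> Z\<close> by simp
    have c: "c > 0" using e pos by (simp add: c_def)
    have c2: "C * (c\<^sup>2 * Z) \<le> e\<^sup>2"
    proof -
      have "C * (c\<^sup>2 * Z) \<le> C * (c\<^sup>2 * (Z + 1))"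
        using C by (intro mult_left_mono) auto
      also have "\<dots> = e\<^sup>2" using pos C \<open>0 \<le> Z\<close> by (simp add: c_def power_divide)
      finally show ?thesis .
    qed
    define \<delta> where "\<delta> k = c / (real k + 1)" for k
    \<comment> \<open>The partial sums of \<open>\<delta>\<close>; they tend to infinity like the harmonic numbers.\<close>
    define \<tau> where "\<tau> n = c * harm n" for n
    have \<delta>0: "\<delta> n > 0" for n using c by (simp add: \<delta>_def add_nonneg_pos)
    have \<tau>\<delta>: "\<tau> (Suc n) - \<tau> n = \<delta> n" for n
      by (simp add: \<tau>_def \<delta>_def harm_Suc inverse_eq_divide add.commute distrib_left)
    have "\<tau> n < \<tau> (Suc n)" for n using \<delta>0[of n] \<tau>\<delta>[of n] by linarith
    then have \<tau>: "strict_mono \<tau>" "\<tau> 0 = 0"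
      by (auto simp: strict_mono_Suc_iff \<tau>_def harm_def)
    have \<tau>_top: "filterlim \<tau> at_top sequentially"
      unfolding \<tau>_def by (rule filterlim_tendsto_pos_mult_at_top[OF tendsto_const c harm_at_top])
    \<comment> \<open>The projected game in the direction \<open>- x\<close> yields an action whose payoffs do not point
      along \<open>x\<close>, up to \<open>\<delta> n\<close>.\<close>
    have "\<exists>p. p \<in> mixed_actions \<and> (\<forall>q\<in>mixed_actions. x \<bullet> mixed_payoff u p q \<le> \<delta> n)" for n x
    proof -
      obtain p where "p \<in> mixed_actions" "\<And>q. q \<in> mixed_actions \<Longrightarrow> (- x) \<bullet> mixed_payoff u p q \<ge> - \<delta> n"
        using near_optimal_action[OF assms[of "- x"] \<delta>0[of n]] by blast
      then show ?thesis by auto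
    qed
    then have "\<exists>P. \<forall>n x. P n x \<in> mixed_actions \<and>
        (\<forall>q\<in>mixed_actions. x \<bullet> mixed_payoff u (P n x) q \<le> \<delta> n)"
      by (intro choice allI)
    then obtain P where P: "\<And>n x. P n x \<in> mixed_actions"
      "\<And>n x q. q \<in> mixed_actions \<Longrightarrow> x \<bullet> mixed_payoff u (P n x) q \<le> \<delta> n"
      by blast
    have sum_le: "(\<Sum>k<n. (\<delta> k)\<^sup>2) \<le> c\<^sup>2 * Z" for n
    proof -
      have "(\<Sum>k<n. (\<delta> k)\<^sup>2) = c\<^sup>2 * (\<Sum>k<n. 1 / (real k + 1)\<^sup>2)"
        by (simp add: \<delta>_def power_divide sum_distrib_left)
      also have "\<dots> \<le> c\<^sup>2 * Z"
        unfolding Z_def by (intro mult_left_mono sum_le_suminf[OF sm]) auto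
      finally show ?thesis .
    qed
    show ?thesis
    proof (intro bexI[of _ "block_strategy u P \<tau>"] allI impI ballI)
      show "block_strategy u P \<tau> \<in> strategies"
        by (rule block_strategy_in_strategies) fact+
      fix t :: real and \<sigma>2 :: "'a control \<Rightarrow> 'b control"
      assume t: "t \<ge> 1" and \<sigma>2: "\<sigma>2 \<in> strategies"
      let ?y = "cumulative_payoff u (block_strategy u P \<tau>) \<sigma>2 t"
      obtain n where "(norm ?y)\<^sup>2 \<le> C * (\<Sum>k<n. (\<delta> k)\<^sup>2)"
        unfolding C_def
        using norm_cumulative_payoff_block_strategy_le[OF \<tau> \<tau>_top \<tau>\<delta> P \<sigma>2, of t] t by auto
      also have "\<dots> \<le> C * (c\<^sup>2 * Z)" using C sum_le by (intro mult_left_mono) auto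
      also have "\<dots> \<le> e\<^sup>2" by (rule c2)
      finally have "norm ?y \<le> e" by (rule power2_le_imp_le) (use e in simp)
      then show "infdist ?y {0} \<le> e" by simp
    qed
  qed
  then show ?thesis unfolding attainable_def attainable_set_def
    by (intro conjI exI[of _ "1::real"] allI impI zero_less_one insert_not_empty closed_singleton)
qed

section \<open>Equivalence of the three properties\<close>

lemma attainable_imp_approachable:
  assumes "attainable u 0"
  shows "approachable u 0"
proof -
  obtain T where T: "T > 0" and att: "\<And>e. e > 0 \<Longrightarrow> \<exists>\<sigma>1\<in>strategies. \<forall>t\<ge>T. \<forall>\<sigma>2\<in>strategies.
      infdist (cumulative_payoff u \<sigma>1 \<sigma>2 t) {0} \<le> e"
    using assms unfolding attainable_def attainable_set_def by blast
  have "\<exists>T>0. \<exists>\<sigma>1\<in>strategies. \<forall>t\<ge>T. \<forall>\<sigma>2\<in>strategies.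
      infdist (average_payoff u \<sigma>1 \<sigma>2 t) {0} \<le> e" if e: "e > 0" for e
  proof -
    obtain \<sigma>1 where \<sigma>1: "\<sigma>1 \<in> strategies" and
      le: "\<And>t \<sigma>2. t \<ge> T \<Longrightarrow> \<sigma>2 \<in> strategies \<Longrightarrow> norm (cumulative_payoff u \<sigma>1 \<sigma>2 t) \<le> e"
      using att[OF e] by auto
    \<comment> \<open>Before time \<open>1\<close> averaging could enlarge the norm.\<close>
    have "norm (average_payoff u \<sigma>1 \<sigma>2 t) \<le> e" if t: "t \<ge> max T 1" and "\<sigma>2 \<in> strategies" for t \<sigma>2
    proof -
      have "norm (average_payoff u \<sigma>1 \<sigma>2 t) = norm (cumulative_payoff u \<sigma>1 \<sigma>2 t) / t"
        using t by (simp add: average_payoff_def)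
      also have "\<dots> \<le> norm (cumulative_payoff u \<sigma>1 \<sigma>2 t)"
        using t by (simp add: divide_le_eq mult_left_le mult_le_cancel_left1)
      also have "\<dots> \<le> e" using le that by simp
      finally show ?thesis .
    qed
    then show ?thesis using \<sigma>1 T
      by (intro exI[of _ "max T 1"]) auto
  qed
  then show ?thesis by (auto simp: approachable_def approachable_set_def)
qed

theorem corollary2:
  fixes u :: "'a::finite \<Rightarrow> 'b::finite \<Rightarrow> real ^ 'm::finite"
  assumes "\<And>i j k. u i j $ k \<in> {-1..1}"
  shows "(attainable u 0 \<longleftrightarrow> approachable u 0) \<and>
         (approachable u 0 \<longleftrightarrow> (\<forall>l. game_value u l \<ge> 0))"
  using attainable_imp_approachable approachable_imp_game_value_nonneg
    game_value_nonneg_imp_attainable by blast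

end
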